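(* Let $L$ be the Fra\"iss\'e limit of the class of all finite nontrivial Heyting algebras. The topological group $\mathrm{Aut}(L)$ is not amenable.
   Context: Heyting algebras are structures in the language $\{0,1,\wedge,\vee,\to\}$; nontrivial means $0\neq 1$. The Fra\"iss\'e limit $L$ is the (unique up to isomorphism) countable Heyting algebra that is ultrahomogeneous (every isomorphism between finitely generated substructures of $L$ extends to an automorphism of $L$) and whose finitely generated substructures are, up to isomorphism, exactly the finite nontrivial Heyting algebras. It is known to exist. $\mathrm{Aut}(L)$ carries the topology of pointwise convergence, in which the pointwise stabilizers of finite subsets of $L$ form a neighbourhood basis of the identity. A topological group $G$ is amenable if every continuous action of $G$ on a nonempty compact Hausdorff space admits a $G$-invariant regular Borel probability measure. *)

theory Defs
  imports "HOL-Probability.Probability_Measure" "HOL-Algebra.Group_Action"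
begin

section \<open>Heyting algebras\<close>

record 'a heyting = "'a partial_object" +
  hzero :: 'a  (\<open>\<^bold>0\<index>\<close>)
  hone :: 'a  (\<open>\<^bold>1\<index>\<close>)
  hmeet :: "'a \<Rightarrow> 'a \<Rightarrow> 'a"  (infixl \<open>\<curlywedge>\<index>\<close> 70)
  hjoin :: "'a \<Rightarrow> 'a \<Rightarrow> 'a"  (infixl \<open>\<curlyvee>\<index>\<close> 65)
  himp :: "'a \<Rightarrow> 'a \<Rightarrow> 'a"  (infixr \<open>\<rightharpoonup>\<index>\<close> 60)

definition closed_under_ops :: "'a heyting \<Rightarrow> 'a set \<Rightarrow> bool"
  where "closed_under_ops L S \<longleftrightarrow> \<^bold>0\<^bsub>L\<^esub> \<in> S \<and> \<^bold>1\<^bsub>L\<^esub> \<in> S \<and>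
    (\<forall>x\<in>S. \<forall>y\<in>S. x \<curlywedge>\<^bsub>L\<^esub> y \<in> S \<and> x \<curlyvee>\<^bsub>L\<^esub> y \<in> S \<and> x \<rightharpoonup>\<^bsub>L\<^esub> y \<in> S)"

text \<open>Bounded lattices with residuation, where \<open>a \<le> b\<close> is expressed as \<open>a \<curlywedge> b = a\<close>.\<close>

locale heyting_algebra =
  fixes L :: "'a heyting" (structure)
  assumes closed: "closed_under_ops L (carrier L)"
    and meet_assoc: "\<lbrakk>x \<in> carrier L; y \<in> carrier L; z \<in> carrier L\<rbrakk>
      \<Longrightarrow> (x \<curlywedge> y) \<curlywedge> z = x \<curlywedge> (y \<curlywedge> z)"
    and join_assoc: "\<lbrakk>x \<in> carrier L; y \<in> carrier L; z \<in> carrier L\<rbrakk>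
      \<Longrightarrow> (x \<curlyvee> y) \<curlyvee> z = x \<curlyvee> (y \<curlyvee> z)"
    and meet_commute: "\<lbrakk>x \<in> carrier L; y \<in> carrier L\<rbrakk> \<Longrightarrow> x \<curlywedge> y = y \<curlywedge> x"
    and join_commute: "\<lbrakk>x \<in> carrier L; y \<in> carrier L\<rbrakk> \<Longrightarrow> x \<curlyvee> y = y \<curlyvee> x"
    and meet_join_absorb: "\<lbrakk>x \<in> carrier L; y \<in> carrier L\<rbrakk> \<Longrightarrow> x \<curlywedge> (x \<curlyvee> y) = x"
    and join_meet_absorb: "\<lbrakk>x \<in> carrier L; y \<in> carrier L\<rbrakk> \<Longrightarrow> x \<curlyvee> (x \<curlywedge> y) = x"
    and zero_join: "x \<in> carrier L \<Longrightarrow> \<^bold>0 \<curlyvee> x = x"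
    and one_meet: "x \<in> carrier L \<Longrightarrow> \<^bold>1 \<curlywedge> x = x"
    and residuation: "\<lbrakk>x \<in> carrier L; y \<in> carrier L; z \<in> carrier L\<rbrakk>
      \<Longrightarrow> (z \<curlywedge> x) \<curlywedge> y = z \<curlywedge> x \<longleftrightarrow> z \<curlywedge> (x \<rightharpoonup> y) = z"

definition finite_nontrivial_heyting :: "'a heyting \<Rightarrow> bool"
  where "finite_nontrivial_heyting A \<longleftrightarrow>
    heyting_algebra A \<and> finite (carrier A) \<and> \<^bold>0\<^bsub>A\<^esub> \<noteq> \<^bold>1\<^bsub>A\<^esub>"

definition heyting_hom :: "'a heyting \<Rightarrow> 'b heyting \<Rightarrow> ('a \<Rightarrow> 'b) set"
  where "heyting_hom A B = {h. h \<in> carrier A \<rightarrow> carrier B \<and>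
    h \<^bold>0\<^bsub>A\<^esub> = \<^bold>0\<^bsub>B\<^esub> \<and> h \<^bold>1\<^bsub>A\<^esub> = \<^bold>1\<^bsub>B\<^esub> \<and>
    (\<forall>x\<in>carrier A. \<forall>y\<in>carrier A.
      h (x \<curlywedge>\<^bsub>A\<^esub> y) = h x \<curlywedge>\<^bsub>B\<^esub> h y \<and>
      h (x \<curlyvee>\<^bsub>A\<^esub> y) = h x \<curlyvee>\<^bsub>B\<^esub> h y \<and>
      h (x \<rightharpoonup>\<^bsub>A\<^esub> y) = h x \<rightharpoonup>\<^bsub>B\<^esub> h y)}"

definition heyting_iso :: "'a heyting \<Rightarrow> 'b heyting \<Rightarrow> ('a \<Rightarrow> 'b) set"
  where "heyting_iso A B = {h \<in> heyting_hom A B. bij_betw h (carrier A) (carrier B)}"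

definition heyting_auto :: "'a heyting \<Rightarrow> ('a \<Rightarrow> 'a) set"
  where "heyting_auto L = heyting_hom L L \<inter> Bij (carrier L)"

definition subalgebra_generated :: "'a heyting \<Rightarrow> 'a set \<Rightarrow> 'a heyting"
  where "subalgebra_generated L X =
    L\<lparr>carrier := \<Inter>{S. X \<subseteq> S \<and> S \<subseteq> carrier L \<and> closed_under_ops L S}\<rparr>"

definition fg_substructures :: "'a heyting \<Rightarrow> 'a heyting set"
  where "fg_substructures L = {subalgebra_generated L X | X. finite X \<and> X \<subseteq> carrier L}"

text \<open>Every finite structure has an isomorphic copy on a subset of \<^typ>\<open>nat\<close>, so it is no
  restriction that the members of the class in \<open>age_complete\<close> live on that type; see
  \<open>age_complete_any\<close> below.\<close>

locale fraisse_limit = heyting_algebra L for L :: "'a heyting" (structure) +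
  assumes countable_carrier: "countable (carrier L)"
    and ultrahomogeneous: "\<lbrakk>A \<in> fg_substructures L; B \<in> fg_substructures L; h \<in> heyting_iso A B\<rbrakk>
      \<Longrightarrow> \<exists>f\<in>heyting_auto L. \<forall>x\<in>carrier A. f x = h x"
    and age_sound: "A \<in> fg_substructures L \<Longrightarrow> finite_nontrivial_heyting A"
    and age_complete: "finite_nontrivial_heyting (N :: nat heyting)
      \<Longrightarrow> \<exists>A\<in>fg_substructures L. heyting_iso A N \<noteq> {}"

lemma heyting_iso_inv_into:
  assumes A: "closed_under_ops A (carrier A)" and h: "h \<in> heyting_iso A B"
  shows "inv_into (carrier A) h \<in> heyting_iso B A"
proof -
  let ?k = "inv_into (carrier A) h"
  have bij: "bij_betw h (carrier A) (carrier B)" and hom: "h \<in> heyting_hom A B"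
    using h by (auto simp: heyting_iso_def)
  have inj: "inj_on h (carrier A)" and im: "h ` carrier A = carrier B"
    using bij by (auto simp: bij_betw_def)
  have k: "?k y \<in> carrier A" "h (?k y) = y" if "y \<in> carrier B" for y
    using that im by (auto simp: inv_into_into f_inv_into_f)
  have eqI: "?k y = a" if "a \<in> carrier A" "h a = y" for a y
    using inj that by (metis inv_into_f_f)
  have "?k \<in> heyting_hom B A"
    unfolding heyting_hom_def mem_Collect_eq
  proof (intro conjI ballI)
    show "?k \<in> carrier B \<rightarrow> carrier A" using k by auto
  qed (rule eqI; use A hom k in \<open>auto simp: closed_under_ops_def heyting_hom_def\<close>)+
  then show ?thesis using bij_betw_inv_into[OF bij] by (simp add: heyting_iso_def)
qed

lemma heyting_iso_comp:
  "\<lbrakk>h \<in> heyting_iso A B; k \<in> heyting_iso B C\<rbrakk> \<Longrightarrow> k \<circ> h \<in> heyting_iso A C"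
  unfolding heyting_iso_def heyting_hom_def
  by (auto intro: bij_betw_trans simp: Pi_iff)

lemma finite_nontrivial_heyting_iso:
  assumes A: "finite_nontrivial_heyting A" and h: "h \<in> heyting_iso A B"
  shows "finite_nontrivial_heyting B"
proof -
  interpret A: heyting_algebra A using A by (simp add: finite_nontrivial_heyting_def)
  have bij: "bij_betw h (carrier A) (carrier B)" and hom: "h \<in> heyting_hom A B"
    using h by (auto simp: heyting_iso_def)
  have im: "carrier B = h ` carrier A" and inj: "inj_on h (carrier A)"
    using bij by (auto simp: bij_betw_def)
  have cl: "\<^bold>0\<^bsub>A\<^esub> \<in> carrier A" "\<^bold>1\<^bsub>A\<^esub> \<in> carrier A"
    "\<And>x y. \<lbrakk>x \<in> carrier A; y \<in> carrier A\<rbrakk> \<Longrightarrow> x \<curlywedge>\<^bsub>A\<^esub> y \<in> carrier A"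
    "\<And>x y. \<lbrakk>x \<in> carrier A; y \<in> carrier A\<rbrakk> \<Longrightarrow> x \<curlyvee>\<^bsub>A\<^esub> y \<in> carrier A"
    "\<And>x y. \<lbrakk>x \<in> carrier A; y \<in> carrier A\<rbrakk> \<Longrightarrow> x \<rightharpoonup>\<^bsub>A\<^esub> y \<in> carrier A"
    using A.closed by (auto simp: closed_under_ops_def)
  have ops: "\<^bold>0\<^bsub>B\<^esub> = h \<^bold>0\<^bsub>A\<^esub>" "\<^bold>1\<^bsub>B\<^esub> = h \<^bold>1\<^bsub>A\<^esub>"
    "\<And>x y. \<lbrakk>x \<in> carrier A; y \<in> carrier A\<rbrakk> \<Longrightarrow> h x \<curlywedge>\<^bsub>B\<^esub> h y = h (x \<curlywedge>\<^bsub>A\<^esub> y)"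
    "\<And>x y. \<lbrakk>x \<in> carrier A; y \<in> carrier A\<rbrakk> \<Longrightarrow> h x \<curlyvee>\<^bsub>B\<^esub> h y = h (x \<curlyvee>\<^bsub>A\<^esub> y)"
    "\<And>x y. \<lbrakk>x \<in> carrier A; y \<in> carrier A\<rbrakk> \<Longrightarrow> h x \<rightharpoonup>\<^bsub>B\<^esub> h y = h (x \<rightharpoonup>\<^bsub>A\<^esub> y)"
    using hom by (auto simp: heyting_hom_def)
  have "heyting_algebra B"
    by unfold_locales
      (auto simp: im ops cl closed_under_ops_def inj_on_eq_iff[OF inj] A.meet_assoc A.join_assoc
        A.meet_join_absorb A.join_meet_absorb A.zero_join A.one_meet A.residuation[symmetric]
        intro: A.meet_commute A.join_commute arg_cong[where f = h])
  moreover have "finite (carrier B)" "\<^bold>0\<^bsub>B\<^esub> \<noteq> \<^bold>1\<^bsub>B\<^esub>"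
    using A cl inj_on_eq_iff[OF inj] by (auto simp: im ops finite_nontrivial_heyting_def)
  ultimately show ?thesis by (simp add: finite_nontrivial_heyting_def)
qed

lemma (in fraisse_limit) age_complete_any:
  fixes B :: "'b heyting"
  assumes B: "finite_nontrivial_heyting B"
  shows "\<exists>A\<in>fg_substructures L. heyting_iso A B \<noteq> {}"
proof -
  have fin: "finite (carrier B)" and clB: "closed_under_ops B (carrier B)"
    using B by (auto simp: finite_nontrivial_heyting_def heyting_algebra_def)
  obtain e :: "'b \<Rightarrow> nat" where e: "inj_on e (carrier B)"
    using finite_imp_inj_to_nat_seg[OF fin] by blast
  let ?d = "inv_into (carrier B) e"
  define N :: "nat heyting" where "N = \<lparr>carrier = e ` carrier B, hzero = e \<^bold>0\<^bsub>B\<^esub>, hone = e \<^bold>1\<^bsub>B\<^esub>,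
    hmeet = (\<lambda>x y. e (?d x \<curlywedge>\<^bsub>B\<^esub> ?d y)), hjoin = (\<lambda>x y. e (?d x \<curlyvee>\<^bsub>B\<^esub> ?d y)),
    himp = (\<lambda>x y. e (?d x \<rightharpoonup>\<^bsub>B\<^esub> ?d y))\<rparr>"
  have iso: "e \<in> heyting_iso B N"
    using e by (auto simp: heyting_iso_def heyting_hom_def N_def bij_betw_def)
  obtain A h where A: "A \<in> fg_substructures L" and h: "h \<in> heyting_iso A N"
    using age_complete[OF finite_nontrivial_heyting_iso[OF B iso]] by blast
  from heyting_iso_comp[OF h heyting_iso_inv_into[OF clB iso]] A show ?thesis by blast
qed


section \<open>Amenable topological groups\<close>

locale topological_group = group G for G (structure) +
  fixes T :: "'a topology"
  assumes topspace: "topspace T = carrier G"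
    and continuous_mult: "continuous_map (prod_topology T T) T (\<lambda>(x, y). x \<otimes> y)"
    and continuous_inv: "continuous_map T T (\<lambda>x. inv x)"

definition continuous_action ::
    "('g, 'm) monoid_scheme \<Rightarrow> 'g topology \<Rightarrow> 'x topology \<Rightarrow> ('g \<Rightarrow> 'x \<Rightarrow> 'x) \<Rightarrow> bool"
  where "continuous_action G T X \<phi> \<longleftrightarrow>
    group_action G (topspace X) \<phi> \<and>
    continuous_map (prod_topology T X) X (\<lambda>(g, x). \<phi> g x)"

definition regular_borel_prob :: "'x topology \<Rightarrow> 'x measure \<Rightarrow> bool"
  where "regular_borel_prob X M \<longleftrightarrow>
    prob_space M \<and> space M = topspace X \<and>
    sets M = sigma_sets (topspace X) {U. openin X U} \<and>
    (\<forall>A\<in>sets M.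
      emeasure M A = (INF U\<in>{U. openin X U \<and> A \<subseteq> U}. emeasure M U) \<and>
      emeasure M A = (SUP K\<in>{K. compactin X K \<and> K \<subseteq> A}. emeasure M K))"

definition invariant_measure ::
    "('g, 'm) monoid_scheme \<Rightarrow> ('g \<Rightarrow> 'x \<Rightarrow> 'x) \<Rightarrow> 'x measure \<Rightarrow> bool"
  where "invariant_measure G \<phi> M \<longleftrightarrow> (\<forall>g\<in>carrier G. distr M M (\<phi> g) = M)"

text \<open>A definition cannot quantify over all types, so the spaces acted upon are taken on the
  type \<^typ>\<open>'g set set\<close>. This is no restriction: an orbit closure in a compact Hausdorff space
  embeds into that type, as \<open>amenable_any\<close> below makes precise.\<close>

definition amenable :: "('g, 'm) monoid_scheme \<Rightarrow> 'g topology \<Rightarrow> bool"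
  where "amenable G T \<longleftrightarrow>
    (\<forall>(X :: 'g set set topology) \<phi>.
      compact_space X \<longrightarrow> Hausdorff_space X \<longrightarrow> topspace X \<noteq> {} \<longrightarrow> continuous_action G T X \<phi> \<longrightarrow>
      (\<exists>M. regular_borel_prob X M \<and> invariant_measure G \<phi> M))"

lemma regular_borel_prob_distr:
  assumes M: "regular_borel_prob X M" and f: "continuous_map X Y f"
    and Y: "Hausdorff_space Y"
    and N: "space N = topspace Y" "sets N = sigma_sets (topspace Y) {U. openin Y U}"
  shows "f \<in> measurable M N" "regular_borel_prob Y (distr M N f)"
proof -
  interpret M: prob_space M using M by (simp add: regular_borel_prob_def)
  have spM: "space M = topspace X"
    and stM: "sets M = sigma_sets (topspace X) {U. openin X U}"
    using M by (simp_all add: regular_borel_prob_def)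
  have reg: "\<And>A. A \<in> sets M \<Longrightarrow>
      emeasure M A = (SUP K\<in>{K. compactin X K \<and> K \<subseteq> A}. emeasure M K)"
    using M unfolding regular_borel_prob_def by blast
  show meas: "f \<in> measurable M N"
  proof (rule measurable_sigma_sets[OF N(2)])
    show "{U. openin Y U} \<subseteq> Pow (topspace Y)" using openin_subset by blast
    show "f \<in> space M \<rightarrow> topspace Y" using f by (auto simp: spM continuous_map_def)
    show "f -` U \<inter> space M \<in> sets M" if "U \<in> {U. openin Y U}" for U
    proof -
      have "f -` U \<inter> space M = {x \<in> topspace X. f x \<in> U}" by (auto simp: spM)
      then show ?thesis using that f by (auto simp: stM continuous_map_def)
    qed
  qed
  let ?D = "distr M N f"
  interpret D: prob_space ?D by (rule M.prob_space_distr[OF meas])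
  have compact_sets: "K \<in> sets N" if "compactin Y K" for K
  proof -
    have "closedin Y K" using that Y compactin_imp_closedin by blast
    then have "topspace Y - (topspace Y - K) \<in> sigma_sets (topspace Y) {U. openin Y U}"
      by (intro sigma_sets.Compl sigma_sets.Basic) (auto simp: closedin_def)
    moreover have "topspace Y - (topspace Y - K) = K"
      using \<open>closedin Y K\<close> closedin_subset by blast
    ultimately show ?thesis by (simp add: N)
  qed
  have inner: "emeasure ?D A = (SUP K\<in>{K. compactin Y K \<and> K \<subseteq> A}. emeasure ?D K)"
    if A: "A \<in> sets N" for A
  proof (rule antisym)
    have pre: "f -` A \<inter> space M \<in> sets M" using meas A by (rule measurable_sets)
    have "emeasure M K \<le> (SUP K\<in>{K. compactin Y K \<and> K \<subseteq> A}. emeasure ?D K)"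
      if K: "compactin X K" "K \<subseteq> f -` A \<inter> space M" for K
    proof -
      have cfK: "compactin Y (f ` K)" using K f image_compactin by blast
      have "emeasure M K \<le> emeasure M (f -` (f ` K) \<inter> space M)"
        using K compact_sets[OF cfK] meas by (intro emeasure_mono) (auto intro: measurable_sets)
      also have "\<dots> = emeasure ?D (f ` K)"
        using compact_sets[OF cfK] meas by (simp add: emeasure_distr)
      also have "\<dots> \<le> (SUP K\<in>{K. compactin Y K \<and> K \<subseteq> A}. emeasure ?D K)"
        using cfK K by (intro SUP_upper) auto
      finally show ?thesis .
    qed
    then show "emeasure ?D A \<le> (SUP K\<in>{K. compactin Y K \<and> K \<subseteq> A}. emeasure ?D K)"
      using A meas reg[OF pre] by (auto simp: emeasure_distr intro!: SUP_least)
    show "(SUP K\<in>{K. compactin Y K \<and> K \<subseteq> A}. emeasure ?D K) \<le> emeasure ?D A"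
      using A by (intro SUP_least emeasure_mono) auto
  qed
  have outer: "emeasure ?D A = (INF U\<in>{U. openin Y U \<and> A \<subseteq> U}. emeasure ?D U)"
    if A: "A \<in> sets N" for A
  proof (rule antisym)
    have open_sets: "U \<in> sets N" if "openin Y U" for U using that by (auto simp: N)
    show "emeasure ?D A \<le> (INF U\<in>{U. openin Y U \<and> A \<subseteq> U}. emeasure ?D U)"
      using open_sets by (intro INF_greatest emeasure_mono) auto
    have AS: "A \<subseteq> topspace Y" using sets.sets_into_space[OF A] by (simp add: N)
    let ?C = "topspace Y - A"
    have C: "?C \<in> sets N" using A by (metis N(1) sets.compl_sets)
    show "(INF U\<in>{U. openin Y U \<and> A \<subseteq> U}. emeasure ?D U) \<le> emeasure ?D A"
    proof (rule ennreal_le_epsilon)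
      fix e :: real assume e: "0 < e"
      have "\<exists>K. compactin Y K \<and> K \<subseteq> ?C \<and> emeasure ?D ?C < emeasure ?D K + ennreal e"
      proof (rule ccontr)
        assume "\<not> ?thesis"
        then have "emeasure ?D K + ennreal e \<le> emeasure ?D ?C"
          if "compactin Y K" "K \<subseteq> ?C" for K using that by (auto simp: not_less)
        then have le: "D.prob K \<le> D.prob ?C - e" if "compactin Y K" "K \<subseteq> ?C" for K
          using that e by (force simp: D.emeasure_eq_measure simp flip: ennreal_plus)
        have ne: "0 \<le> D.prob ?C - e" using le[of "{}"] by simp
        have "emeasure ?D ?C \<le> ennreal (D.prob ?C - e)"
          unfolding inner[OF C] using le
          by (auto intro!: SUP_least ennreal_leI simp: D.emeasure_eq_measure)
        then show False using e ne by (simp add: D.emeasure_eq_measure)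
      qed
      then obtain K where K: "compactin Y K" "K \<subseteq> ?C"
        and lt: "emeasure ?D ?C < emeasure ?D K + ennreal e" by blast
      have "D.prob ?C < D.prob K + e"
        using lt e by (simp add: D.emeasure_eq_measure ennreal_less_iff flip: ennreal_plus)
      moreover have "D.prob ?C = 1 - D.prob A" "D.prob (topspace Y - K) = 1 - D.prob K"
        using D.prob_compl[of A] D.prob_compl[of K] A compact_sets[OF K(1)] by (simp_all add: N(1))
      ultimately have "D.prob (topspace Y - K) \<le> D.prob A + e" by simp
      then have "emeasure ?D (topspace Y - K) \<le> emeasure ?D A + ennreal e"
        using e by (simp add: D.emeasure_eq_measure ennreal_leI flip: ennreal_plus)
      moreover have "openin Y (topspace Y - K)" "A \<subseteq> topspace Y - K"
        using K Y AS compactin_imp_closedin by (auto simp: closedin_def)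
      ultimately show "(INF U\<in>{U. openin Y U \<and> A \<subseteq> U}. emeasure ?D U) \<le> emeasure ?D A + ennreal e"
        by (intro INF_lower2[of "topspace Y - K"]) auto
    qed
  qed
  show "regular_borel_prob Y ?D"
    unfolding regular_borel_prob_def
  proof (intro conjI ballI)
    show "prob_space ?D" by (rule D.prob_space_axioms)
    show "space ?D = topspace Y" "sets ?D = sigma_sets (topspace Y) {U. openin Y U}"
      by (simp_all add: N)
    fix A assume "A \<in> sets ?D"
    then have A: "A \<in> sets N" by simp
    show "emeasure ?D A = (INF U\<in>{U. openin Y U \<and> A \<subseteq> U}. emeasure ?D U)" by (rule outer[OF A])
    show "emeasure ?D A = (SUP K\<in>{K. compactin Y K \<and> K \<subseteq> A}. emeasure ?D K)" by (rule inner[OF A])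
  qed
qed

lemma group_actionI:
  fixes G (structure)
  assumes "group G" and ext: "\<And>g. g \<in> carrier G \<Longrightarrow> \<phi> g \<in> extensional E"
    and closed: "\<And>g x. \<lbrakk>g \<in> carrier G; x \<in> E\<rbrakk> \<Longrightarrow> \<phi> g x \<in> E"
    and one: "\<And>x. x \<in> E \<Longrightarrow> \<phi> \<one> x = x"
    and mult: "\<And>g h x. \<lbrakk>g \<in> carrier G; h \<in> carrier G; x \<in> E\<rbrakk> \<Longrightarrow> \<phi> (g \<otimes> h) x = \<phi> g (\<phi> h x)"
  shows "group_action G E \<phi>"
proof -
  interpret group G by fact
  have Bij: "\<phi> g \<in> Bij E" if g: "g \<in> carrier G" for g
  proof -
    have "bij_betw (\<phi> g) E E"
    proof (rule bij_betw_byWitness[where f' = "\<phi> (inv g)"])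
      show "\<forall>x\<in>E. \<phi> (inv g) (\<phi> g x) = x" "\<forall>x\<in>E. \<phi> g (\<phi> (inv g) x) = x"
        using g by (auto simp: one simp flip: mult)
    qed (use g closed in auto)
    then show ?thesis using ext[OF g] by (simp add: Bij_def)
  qed
  have "\<phi> (g \<otimes> h) = compose E (\<phi> g) (\<phi> h)" if "g \<in> carrier G" "h \<in> carrier G" for g h
    by (rule extensionalityI[of _ E]) (use that in \<open>auto simp: ext mult compose_def\<close>)
  then have "\<phi> \<in> hom G (BijGroup E)"
    using Bij by (auto simp: hom_def BijGroup_def)
  then show ?thesis
    by (simp add: group_action_def group_hom_def group_hom_axioms_def group_BijGroup is_group)
qed

lemma continuous_action_continuous_map:
  assumes "continuous_action G T X \<phi>" "topspace T = carrier G" "g \<in> carrier G"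
  shows "continuous_map X X (\<phi> g)"
proof -
  have "continuous_map X (prod_topology T X) (\<lambda>x. (g, x))"
    using assms by (auto simp: continuous_map_pairwise o_def)
  from continuous_map_compose[OF this, of X "\<lambda>(g, x). \<phi> g x"] assms show ?thesis
    by (auto simp: continuous_action_def o_def)
qed

lemma amenable_any:
  fixes X :: "'x topology" and G :: "('g, 'm) monoid_scheme"
  assumes am: "amenable G T" and T: "topspace T = carrier G"
    and X: "compact_space X" "Hausdorff_space X" "topspace X \<noteq> {}"
    and act: "continuous_action G T X \<phi>"
  shows "\<exists>M. regular_borel_prob X M \<and> invariant_measure G \<phi> M"
proof -
  have ga: "group_action G (topspace X) \<phi>"
    and cont: "continuous_map (prod_topology T X) X (\<lambda>(g, x). \<phi> g x)"
    using act by (auto simp: continuous_action_def)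
  interpret group_action G "topspace X" \<phi> by (rule ga)
  interpret group_hom G "BijGroup (topspace X)" \<phi> by (rule group_hom)
  obtain x0 where x0: "x0 \<in> topspace X" using X by blast
  define Orb where "Orb = (\<lambda>g. \<phi> g x0) ` carrier G"
  define Y where "Y = X closure_of Orb"
  define SY where "SY = subtopology X Y"
  have \<phi>_in: "\<phi> g x \<in> topspace X" if "g \<in> carrier G" "x \<in> topspace X" for g x
    using that surj_prop by blast
  have OX: "Orb \<subseteq> topspace X" using \<phi>_in x0 by (auto simp: Orb_def)
  have OY: "Orb \<subseteq> Y" by (simp add: OX Y_def closure_of_subset)
  have YX: "Y \<subseteq> topspace X" by (simp add: Y_def closure_of_subset_topspace)
  have Yne: "Y \<noteq> {}" using OY by (force simp: Orb_def)
  have tsSY: "topspace SY = Y" using YX by (auto simp: SY_def)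
  have cSY: "compact_space SY" "Hausdorff_space SY"
    using X by (auto simp: SY_def Y_def compact_space_subtopology closedin_compact_space
        Hausdorff_space_subtopology)
  have gx_mult: "\<phi> (g \<otimes>\<^bsub>G\<^esub> h) x = \<phi> g (\<phi> h x)"
    if "g \<in> carrier G" "h \<in> carrier G" "x \<in> topspace X" for g h x
    using composition_rule that by blast
  have \<phi>_cont: "continuous_map X X (\<phi> g)" if "g \<in> carrier G" for g
    by (rule continuous_action_continuous_map[OF act T that])
  have \<phi>_Y: "\<phi> g y \<in> Y" if g: "g \<in> carrier G" and y: "y \<in> Y" for g y
  proof -
    have "\<phi> g ` Y \<subseteq> X closure_of (\<phi> g ` Orb)"
      unfolding Y_def by (rule continuous_map_image_closure_subset[OF \<phi>_cont[OF g]])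
    moreover have "\<phi> g ` Orb \<subseteq> Orb"
    proof
      fix z assume "z \<in> \<phi> g ` Orb"
      then obtain h where h: "h \<in> carrier G" "z = \<phi> g (\<phi> h x0)" by (auto simp: Orb_def)
      then have "z = \<phi> (g \<otimes>\<^bsub>G\<^esub> h) x0" using gx_mult g x0 by simp
      moreover have "g \<otimes>\<^bsub>G\<^esub> h \<in> carrier G" using g h by simp
      ultimately show "z \<in> Orb" unfolding Orb_def by blast
    qed
    then have "X closure_of (\<phi> g ` Orb) \<subseteq> Y"
      unfolding Y_def by (rule closure_of_mono)
    ultimately show ?thesis using y by blast
  qed
  define e where
    "e y = {S. S \<subseteq> carrier G \<and> y \<in> X closure_of ((\<lambda>g. \<phi> g x0) ` S)}" for y
  have "inj_on e Y"
  proof (rule inj_onI, rule ccontr)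
    fix y y' assume y: "y \<in> Y" "y' \<in> Y" and eq: "e y = e y'" and "y \<noteq> y'"
    then obtain U V where UV: "openin X U" "openin X V" "y \<in> U" "y' \<in> V" "disjnt U V"
      using X(2) YX by (meson Hausdorff_space_def subsetD)
    let ?S = "{g \<in> carrier G. \<phi> g x0 \<in> U}"
    have "y \<in> X closure_of ((\<lambda>g. \<phi> g x0) ` ?S)"
      unfolding in_closure_of
    proof (intro conjI allI impI)
      show "y \<in> topspace X" using y YX by blast
      fix W assume "y \<in> W \<and> openin X W"
      then have "y \<in> U \<inter> W" "openin X (U \<inter> W)" using UV by auto
      then obtain z where "z \<in> Orb" "z \<in> U \<inter> W" using y(1) unfolding Y_def in_closure_of by blast
      then show "\<exists>z. z \<in> (\<lambda>g. \<phi> g x0) ` ?S \<and> z \<in> W" by (auto simp: Orb_def)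
    qed
    then have "?S \<in> e y'" using eq by (auto simp: e_def)
    then have "y' \<in> X closure_of ((\<lambda>g. \<phi> g x0) ` ?S)" by (simp add: e_def)
    then obtain z where "z \<in> (\<lambda>g. \<phi> g x0) ` ?S" "z \<in> V"
      using UV unfolding in_closure_of by blast
    then show False using UV by (auto simp: disjnt_iff)
  qed
  define d where "d = inv_into Y e"
  have de [simp]: "d (e y) = y" if "y \<in> Y" for y
    using that \<open>inj_on e Y\<close> by (simp add: d_def)
  define Z where "Z = pullback_topology (e ` Y) d SY"
  have tsZ: "topspace Z = e ` Y" by (auto simp: Z_def topspace_pullback_topology tsSY)
  have d_cont: "continuous_map Z SY d"
    using continuous_map_pullback[of SY SY id "e ` Y" d] by (simp add: Z_def)
  have e_cont: "continuous_map SY Z e"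
    unfolding continuous_map_def
  proof (intro conjI allI impI)
    show "e \<in> topspace SY \<rightarrow> topspace Z" by (simp add: tsSY tsZ)
    fix V assume "openin Z V"
    then obtain U where U: "openin SY U" "V = d -` U \<inter> e ` Y"
      by (auto simp: Z_def openin_pullback_topology)
    then have "{y \<in> topspace SY. e y \<in> V} = U" using openin_subset[OF U(1)] by (auto simp: tsSY)
    then show "openin SY {y \<in> topspace SY. e y \<in> V}" using U by simp
  qed
  have "homeomorphic_maps SY Z e d"
    using d_cont e_cont by (auto simp: homeomorphic_maps_def tsZ tsSY)
  then have "SY homeomorphic_space Z" by (auto simp: homeomorphic_space_def)
  then have cZ: "compact_space Z" "Hausdorff_space Z"
    using cSY homeomorphic_compact_space homeomorphic_Hausdorff_space by blast+
  define \<psi> where "\<psi> g = (\<lambda>u\<in>e ` Y. e (\<phi> g (d u)))" for g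
  have "group_action G (topspace Z) \<psi>"
    unfolding tsZ
  proof (rule group_actionI)
    show "\<psi> \<one>\<^bsub>G\<^esub> u = u" if "u \<in> e ` Y" for u
      using that YX id_eq_one[symmetric] by (auto simp: \<psi>_def)
    show "\<psi> (g \<otimes>\<^bsub>G\<^esub> h) u = \<psi> g (\<psi> h u)"
      if "g \<in> carrier G" "h \<in> carrier G" "u \<in> e ` Y" for g h u
      using that YX by (auto simp: \<psi>_def \<phi>_Y gx_mult subsetD simp del: hom_mult)
  qed (auto simp: \<psi>_def \<phi>_Y)
  moreover have "continuous_map (prod_topology T Z) Z (\<lambda>(g, u). \<psi> g u)"
  proof -
    have "continuous_map (prod_topology T Z) X (d \<circ> snd)"
      using continuous_map_snd d_cont continuous_map_compose continuous_map_into_fulltopology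
      unfolding SY_def by blast
    then have "continuous_map (prod_topology T Z) (prod_topology T X) (\<lambda>p. (fst p, d (snd p)))"
      by (auto simp: continuous_map_pairwise o_def continuous_map_fst)
    from continuous_map_compose[OF this cont]
    have "continuous_map (prod_topology T Z) X (\<lambda>p. \<phi> (fst p) (d (snd p)))"
      by (simp add: o_def)
    then have "continuous_map (prod_topology T Z) SY (\<lambda>p. \<phi> (fst p) (d (snd p)))"
      by (auto simp: SY_def continuous_map_in_subtopology tsZ T \<phi>_Y)
    from continuous_map_compose[OF this e_cont]
    show ?thesis
      by (rule continuous_map_eq) (auto simp: tsZ \<psi>_def)
  qed
  ultimately have "continuous_action G T Z \<psi>" by (simp add: continuous_action_def)
  with am cZ tsZ Yne obtain M' where M': "regular_borel_prob Z M'" "invariant_measure G \<psi> M'"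
    unfolding amenable_def by blast
  have spM': "space M' = topspace Z" and stM': "sets M' = sigma_sets (topspace Z) {U. openin Z U}"
    using M'(1) unfolding regular_borel_prob_def by blast+
  define N where "N = sigma (topspace X) {U. openin X U}"
  have "{U. openin X U} \<subseteq> Pow (topspace X)" using openin_subset by blast
  then have N: "space N = topspace X" "sets N = sigma_sets (topspace X) {U. openin X U}"
    by (simp_all add: N_def)
  have dX: "continuous_map Z X d"
    using d_cont continuous_map_into_fulltopology unfolding SY_def by blast
  note dm = regular_borel_prob_distr[OF M'(1) dX X(2) N]
  have "distr (distr M' N d) (distr M' N d) (\<phi> g) = distr M' N d" if g: "g \<in> carrier G" for g
  proof -
    have "\<phi> g \<in> measurable (distr M' N d) N"
      by (rule regular_borel_prob_distr[OF dm(2) \<phi>_cont[OF g] X(2) N])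
    then have \<phi>m: "\<phi> g \<in> measurable N N" by simp
    have "continuous_map Z Z (\<psi> g)"
      by (rule continuous_action_continuous_map[OF \<open>continuous_action G T Z \<psi>\<close> T g])
    then have \<psi>m: "\<psi> g \<in> measurable M' M'"
      by (rule regular_borel_prob_distr(1)[OF M'(1) _ cZ(2) spM' stM'])
    have "distr (distr M' N d) (distr M' N d) (\<phi> g) = distr (distr M' N d) N (\<phi> g)"
      by (rule distr_cong) auto
    also have "\<dots> = distr M' N (\<phi> g \<circ> d)"
      by (rule distr_distr[OF \<phi>m dm(1)])
    also have "\<dots> = distr M' N (d \<circ> \<psi> g)"
      using g by (intro distr_cong) (auto simp: spM' tsZ \<psi>_def \<phi>_Y)
    also have "\<dots> = distr (distr M' M' (\<psi> g)) N d"
      by (rule distr_distr[OF dm(1) \<psi>m, symmetric])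
    also have "\<dots> = distr M' N d"
      using M'(2) g by (simp add: invariant_measure_def)
    finally show ?thesis .
  qed
  then show ?thesis using dm(2) by (auto simp: invariant_measure_def)
qed


section \<open>The automorphism group\<close>

definition Aut :: "'a heyting \<Rightarrow> ('a \<Rightarrow> 'a) monoid"
  where "Aut L = BijGroup (carrier L)\<lparr>carrier := heyting_auto L\<rparr>"

definition pointwise_topology :: "'a heyting \<Rightarrow> ('a \<Rightarrow> 'a) topology"
  where "pointwise_topology L =
    subtopology (product_topology (\<lambda>_. discrete_topology (carrier L)) (carrier L)) (heyting_auto L)"

lemma heyting_autoD:
  assumes "f \<in> heyting_auto L"
  shows "f \<in> Bij (carrier L)" "f \<in> heyting_iso L L" "f \<in> extensional (carrier L)"
    "x \<in> carrier L \<Longrightarrow> f x \<in> carrier L"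
  using assms by (auto simp: heyting_auto_def heyting_iso_def heyting_hom_def Bij_def)

lemma (in heyting_algebra) subgroup_heyting_auto:
  "subgroup (heyting_auto L) (BijGroup (carrier L))"
proof -
  interpret B: group "BijGroup (carrier L)" by (rule group_BijGroup)
  show ?thesis
  proof (rule B.subgroupI)
    show "heyting_auto L \<subseteq> carrier (BijGroup (carrier L))"
      by (auto simp: heyting_auto_def BijGroup_def)
    have "(\<lambda>x\<in>carrier L. x) \<in> heyting_auto L"
      using closed id_Bij by (auto simp: heyting_auto_def heyting_hom_def closed_under_ops_def)
    then show "heyting_auto L \<noteq> {}" by blast
  next
    fix f assume f: "f \<in> heyting_auto L"
    have "inv_into (carrier L) f \<in> heyting_hom L L"
      using heyting_iso_inv_into[OF closed heyting_autoD(2)[OF f]] by (simp add: heyting_iso_def)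
    then have "restrict (inv_into (carrier L) f) (carrier L) \<in> heyting_auto L"
      using restrict_inv_into_Bij[OF heyting_autoD(1)[OF f]] closed
      by (auto simp: heyting_auto_def heyting_hom_def closed_under_ops_def)
    then show "inv\<^bsub>BijGroup (carrier L)\<^esub> f \<in> heyting_auto L"
      using inv_BijGroup[OF heyting_autoD(1)[OF f]] by simp
  next
    fix f g assume f: "f \<in> heyting_auto L" and g: "g \<in> heyting_auto L"
    have "compose (carrier L) f g \<in> heyting_auto L"
      using f g compose_Bij[of f "carrier L" g] closed
      by (auto simp: heyting_auto_def heyting_hom_def closed_under_ops_def compose_def Pi_iff)
    then show "f \<otimes>\<^bsub>BijGroup (carrier L)\<^esub> g \<in> heyting_auto L"
      using f g by (simp add: BijGroup_def heyting_autoD)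
  qed
qed

lemma topspace_pointwise_topology: "topspace (pointwise_topology L) = heyting_auto L"
  by (auto simp: pointwise_topology_def heyting_autoD PiE_def)

lemma continuous_map_into_pointwise_topology:
  "continuous_map X (pointwise_topology L) F \<longleftrightarrow>
    F \<in> topspace X \<rightarrow> heyting_auto L \<and>
    (\<forall>x\<in>carrier L. \<forall>y\<in>carrier L. openin X {p \<in> topspace X. F p x = y})"
  (is "?lhs \<longleftrightarrow> ?A \<and> ?B")
proof -
  have "continuous_map X (discrete_topology (carrier L)) (\<lambda>p. F p x) \<longleftrightarrow>
      (\<forall>y\<in>carrier L. openin X {p \<in> topspace X. F p x = y})"
    if x: "x \<in> carrier L" and ?A for x
  proof
    show "\<forall>y\<in>carrier L. openin X {p \<in> topspace X. F p x = y}"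
      if "continuous_map X (discrete_topology (carrier L)) (\<lambda>p. F p x)"
      using openin_continuous_map_preimage[OF that, of "{_}"] by simp
  next
    assume op: "\<forall>y\<in>carrier L. openin X {p \<in> topspace X. F p x = y}"
    show "continuous_map X (discrete_topology (carrier L)) (\<lambda>p. F p x)"
      unfolding continuous_map_def
    proof (intro conjI allI impI)
      show "(\<lambda>p. F p x) \<in> topspace X \<rightarrow> topspace (discrete_topology (carrier L))"
        using \<open>?A\<close> x by (auto intro: heyting_autoD)
      fix U assume "openin (discrete_topology (carrier L)) U"
      then have "openin X (\<Union>y\<in>U. {p \<in> topspace X. F p x = y})" using op by auto
      also have "(\<Union>y\<in>U. {p \<in> topspace X. F p x = y}) = {p \<in> topspace X. F p x \<in> U}" by auto
      finally show "openin X {p \<in> topspace X. F p x \<in> U}" .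
    qed
  qed
  then show ?thesis
    unfolding pointwise_topology_def continuous_map_in_subtopology continuous_map_componentwise
    by (auto simp: Pi_iff image_subset_iff heyting_autoD)
qed

lemma openin_pointwise_topology_eval:
  assumes "x \<in> carrier L" "y \<in> carrier L"
  shows "openin (pointwise_topology L) {f \<in> heyting_auto L. f x = y}"
  using continuous_map_into_pointwise_topology[of "pointwise_topology L" L "\<lambda>f. f"] assms
  by (simp add: topspace_pointwise_topology)

lemma (in heyting_algebra) topological_group_Aut:
  "topological_group (Aut L) (pointwise_topology L)"
proof -
  interpret B: group "BijGroup (carrier L)" by (rule group_BijGroup)
  let ?T = "pointwise_topology L"
  have carr: "carrier (Aut L) = heyting_auto L" by (simp add: Aut_def)
  have grp: "group (Aut L)"
    using B.subgroup_imp_group[OF subgroup_heyting_auto] by (simp add: Aut_def)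
  then interpret A: group "Aut L" .
  have mult: "(f \<otimes>\<^bsub>Aut L\<^esub> g) x = f (g x)"
    if "f \<in> heyting_auto L" "g \<in> heyting_auto L" "x \<in> carrier L" for f g x
    using that by (simp add: Aut_def BijGroup_def heyting_autoD compose_def)
  have one: "\<one>\<^bsub>Aut L\<^esub> x = x" if "x \<in> carrier L" for x
    using that by (simp add: Aut_def BijGroup_def)
  have inv_eq: "(inv\<^bsub>Aut L\<^esub> f) x = y \<longleftrightarrow> f y = x"
    if "f \<in> heyting_auto L" "x \<in> carrier L" "y \<in> carrier L" for f x y
  proof -
    have "f ((inv\<^bsub>Aut L\<^esub> f) x) = x" "(inv\<^bsub>Aut L\<^esub> f) (f y) = y"
      using that mult[of f "inv\<^bsub>Aut L\<^esub> f" x] mult[of "inv\<^bsub>Aut L\<^esub> f" f y]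
        one A.inv_closed[of f] A.r_inv[of f] A.l_inv[of f] by (simp_all add: carr)
    then show ?thesis by auto
  qed
  show ?thesis
  proof (unfold_locales)
    show "topspace ?T = carrier (Aut L)"
      by (simp add: topspace_pointwise_topology carr)
    show "continuous_map (prod_topology ?T ?T) ?T (\<lambda>(f, g). f \<otimes>\<^bsub>Aut L\<^esub> g)"
      unfolding continuous_map_into_pointwise_topology
    proof (intro conjI ballI)
      show "(\<lambda>(f, g). f \<otimes>\<^bsub>Aut L\<^esub> g) \<in> topspace (prod_topology ?T ?T) \<rightarrow> heyting_auto L"
        using A.m_closed by (auto simp: topspace_pointwise_topology carr)
      fix x y assume xy: "x \<in> carrier L" "y \<in> carrier L"
      have "openin (prod_topology ?T ?T)
        (\<Union>z\<in>carrier L. {f \<in> heyting_auto L. f z = y} \<times> {g \<in> heyting_auto L. g x = z})"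
        using xy by (intro openin_Union) (auto simp: openin_prod_Times_iff openin_pointwise_topology_eval)
      also have "(\<Union>z\<in>carrier L. {f \<in> heyting_auto L. f z = y} \<times> {g \<in> heyting_auto L. g x = z}) =
        {p \<in> topspace (prod_topology ?T ?T). (case p of (f, g) \<Rightarrow> f \<otimes>\<^bsub>Aut L\<^esub> g) x = y}"
        using xy by (auto simp: topspace_pointwise_topology mult heyting_autoD)
      finally show "openin (prod_topology ?T ?T)
        {p \<in> topspace (prod_topology ?T ?T). (case p of (f, g) \<Rightarrow> f \<otimes>\<^bsub>Aut L\<^esub> g) x = y}" .
    qed
    show "continuous_map ?T ?T (\<lambda>f. inv\<^bsub>Aut L\<^esub> f)"
      unfolding continuous_map_into_pointwise_topology
    proof (intro conjI ballI)
      show "(\<lambda>f. inv\<^bsub>Aut L\<^esub> f) \<in> topspace ?T \<rightarrow> heyting_auto L"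
        using A.inv_closed by (auto simp: topspace_pointwise_topology carr)
      fix x y assume xy: "x \<in> carrier L" "y \<in> carrier L"
      then have "{f \<in> topspace ?T. (inv\<^bsub>Aut L\<^esub> f) x = y} = {f \<in> heyting_auto L. f y = x}"
        using inv_eq[OF _ xy] by (simp add: topspace_pointwise_topology cong: conj_cong)
      then show "openin ?T {f \<in> topspace ?T. (inv\<^bsub>Aut L\<^esub> f) x = y}"
        using xy by (simp add: openin_pointwise_topology_eval)
    qed
  qed
qed

lemma (in heyting_algebra) pointwise_topology_nhds_one:
  "(\<exists>V. openin (pointwise_topology L) V \<and> \<one>\<^bsub>Aut L\<^esub> \<in> V \<and> V \<subseteq> U) \<longleftrightarrow>
    (\<exists>F. finite F \<and> F \<subseteq> carrier L \<and> {f \<in> heyting_auto L. \<forall>x\<in>F. f x = x} \<subseteq> U)"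
proof
  let ?P = "product_topology (\<lambda>_. discrete_topology (carrier L)) (carrier L)"
  have one: "\<one>\<^bsub>Aut L\<^esub> x = x" if "x \<in> carrier L" for x
    using that by (simp add: Aut_def BijGroup_def)
  {
    assume "\<exists>V. openin (pointwise_topology L) V \<and> \<one>\<^bsub>Aut L\<^esub> \<in> V \<and> V \<subseteq> U"
    then obtain W where W: "openin ?P W" "\<one>\<^bsub>Aut L\<^esub> \<in> W" "W \<inter> heyting_auto L \<subseteq> U"
      by (auto simp: pointwise_topology_def openin_subtopology)
    obtain D where D: "\<one>\<^bsub>Aut L\<^esub> \<in> PiE (carrier L) D" "finite {x. D x \<noteq> carrier L}"
        "PiE (carrier L) D \<subseteq> W"
      using product_topology_open_contains_basis[OF W(1,2)] by auto
    let ?F = "{x. D x \<noteq> carrier L} \<inter> carrier L"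
    have "{f \<in> heyting_auto L. \<forall>x\<in>?F. f x = x} \<subseteq> PiE (carrier L) D"
    proof (clarify, rule PiE_I)
      fix f x assume f: "f \<in> heyting_auto L" "\<forall>x\<in>?F. f x = x" and x: "x \<in> carrier L"
      have "x \<in> D x" using D(1) one[OF x] x by (metis PiE_mem)
      then show "f x \<in> D x" using f x heyting_autoD(4)[OF f(1) x] by (cases "D x = carrier L") auto
    qed (auto dest!: heyting_autoD(3) simp: extensional_def)
    with D W show "\<exists>F. finite F \<and> F \<subseteq> carrier L \<and> {f \<in> heyting_auto L. \<forall>x\<in>F. f x = x} \<subseteq> U"
      by (intro exI[of _ ?F]) blast
  }
  {
    assume "\<exists>F. finite F \<and> F \<subseteq> carrier L \<and> {f \<in> heyting_auto L. \<forall>x\<in>F. f x = x} \<subseteq> U"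
    then obtain F where F: "finite F" "F \<subseteq> carrier L" "{f \<in> heyting_auto L. \<forall>x\<in>F. f x = x} \<subseteq> U"
      by blast
    let ?V = "topspace (pointwise_topology L) \<inter> (\<Inter>x\<in>F. {f \<in> heyting_auto L. f x = x})"
    have "openin (pointwise_topology L) ?V"
      using F by (intro openin_Int_Inter) (auto intro: openin_pointwise_topology_eval)
    moreover have "\<one>\<^bsub>Aut L\<^esub> \<in> heyting_auto L"
      using subgroup.one_closed[OF subgroup_heyting_auto] by (simp add: Aut_def)
    then have "\<one>\<^bsub>Aut L\<^esub> \<in> ?V"
      using F one by (auto simp: topspace_pointwise_topology)
    moreover have "?V \<subseteq> U" using F by (auto simp: topspace_pointwise_topology)
    ultimately show "\<exists>V. openin (pointwise_topology L) V \<and> \<one>\<^bsub>Aut L\<^esub> \<in> V \<and> V \<subseteq> U" by blast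
  }
qed

end

theory Submission
  imports Defs
begin

text \<open>The group acts on the compact space of ultrafilters of \<open>L\<close>, and an invariant measure assigns
  to each \<open>a \<in> L\<close> the mass of the ultrafilters containing \<open>a\<close>. All complemented elements other than
  \<open>0\<close> and \<open>1\<close> generate isomorphic four-element subalgebras, so by ultrahomogeneity they have the same
  mass. A complementary pair forces this mass to be \<open>1/2\<close>, whereas the three atoms of an
  eight-element Boolean subalgebra force it to be \<open>1/3\<close>.\<close>

section \<open>Ultrafilters of a Heyting algebra\<close>

context heyting_algebra
begin

lemma op_closed [simp]:
  "\<^bold>0 \<in> carrier L" "\<^bold>1 \<in> carrier L"
  "\<lbrakk>x \<in> carrier L; y \<in> carrier L\<rbrakk> \<Longrightarrow> x \<curlywedge> y \<in> carrier L"
  "\<lbrakk>x \<in> carrier L; y \<in> carrier L\<rbrakk> \<Longrightarrow> x \<curlyvee> y \<in> carrier L"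
  "\<lbrakk>x \<in> carrier L; y \<in> carrier L\<rbrakk> \<Longrightarrow> x \<rightharpoonup> y \<in> carrier L"
  using closed by (auto simp: closed_under_ops_def)

lemma meet_idem: "x \<in> carrier L \<Longrightarrow> x \<curlywedge> x = x"
  using meet_join_absorb[of x "x \<curlywedge> x"] join_meet_absorb[of x x] by simp

lemma meet_zero: "x \<in> carrier L \<Longrightarrow> x \<curlywedge> \<^bold>0 = \<^bold>0"
  using meet_join_absorb[of "\<^bold>0" x] zero_join[of x] meet_commute[of x "\<^bold>0"] by simp

text \<open>Residuation, applied to the negation of x as the lower bound, turns the idempotence of
  that negation into the statement that its meet with x lies below 0.\<close>

lemma meet_neg: "x \<in> carrier L \<Longrightarrow> x \<curlywedge> (x \<rightharpoonup> \<^bold>0) = \<^bold>0"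
  using residuation[of x "\<^bold>0" "x \<rightharpoonup> \<^bold>0"] meet_idem[of "x \<rightharpoonup> \<^bold>0"] meet_commute[of x "x \<rightharpoonup> \<^bold>0"]
    meet_zero[of "x \<curlywedge> (x \<rightharpoonup> \<^bold>0)"] by simp

lemma meet_left_commute:
  "\<lbrakk>x \<in> carrier L; y \<in> carrier L; z \<in> carrier L\<rbrakk> \<Longrightarrow> x \<curlywedge> (y \<curlywedge> z) = y \<curlywedge> (x \<curlywedge> z)"
  using meet_assoc meet_commute by metis

text \<open>The single equivalence for meets covers two axioms: right to left it is closure under
  meets, left to right it is upward closure, because x below y means that x is its own meet with
  y.\<close>

definition proper_filter :: "'a set \<Rightarrow> bool"
  where "proper_filter F \<longleftrightarrow> F \<subseteq> carrier L \<and> \<^bold>1 \<in> F \<and> \<^bold>0 \<notin> F \<and>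
    (\<forall>x\<in>carrier L. \<forall>y\<in>carrier L. x \<curlywedge> y \<in> F \<longleftrightarrow> x \<in> F \<and> y \<in> F)"

text \<open>The extension is the filter generated by \<open>F\<close> and \<open>x\<close>, namely
  everything above some f \<curlywedge> x with f in \<open>F\<close>. Were 0 in it, residuation
  would put such an f below the negation of x, and that negation would then belong to
  \<open>F\<close>.\<close>

lemma proper_filter_extend:
  assumes F: "proper_filter F" and x: "x \<in> carrier L" and neg: "x \<rightharpoonup> \<^bold>0 \<notin> F"
  shows "\<exists>F'. proper_filter F' \<and> F \<subseteq> F' \<and> x \<in> F'"
proof -
  define N where "N = {z \<in> carrier L. \<exists>f\<in>F. (f \<curlywedge> x) \<curlywedge> z = f \<curlywedge> x}"
  have FL: "F \<subseteq> carrier L" and one: "\<^bold>1 \<in> F"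
    and meet: "\<And>y z. \<lbrakk>y \<in> carrier L; z \<in> carrier L\<rbrakk> \<Longrightarrow> y \<curlywedge> z \<in> F \<longleftrightarrow> y \<in> F \<and> z \<in> F"
    using F by (auto simp: proper_filter_def)
  note ac = meet_assoc meet_commute meet_left_commute
  have "F \<subseteq> N"
  proof
    fix f assume f: "f \<in> F"
    then have "(f \<curlywedge> x) \<curlywedge> f = f \<curlywedge> x"
      using FL x meet_idem[of f] by (metis meet_assoc meet_commute subsetD)
    then show "f \<in> N" using f FL by (auto simp: N_def)
  qed
  moreover have "x \<in> N"
    using one x by (auto simp: N_def one_meet meet_idem intro!: bexI[of _ "\<^bold>1"])
  moreover have "proper_filter N"
    unfolding proper_filter_def
  proof (intro conjI ballI iffI)
    show "N \<subseteq> carrier L" "\<^bold>1 \<in> N" using \<open>F \<subseteq> N\<close> one by (auto simp: N_def)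
    show "\<^bold>0 \<notin> N"
    proof
      assume "\<^bold>0 \<in> N"
      then obtain f where f: "f \<in> F" "(f \<curlywedge> x) \<curlywedge> \<^bold>0 = f \<curlywedge> x" by (auto simp: N_def)
      then have "f \<curlywedge> (x \<rightharpoonup> \<^bold>0) = f" using residuation x FL by auto
      then show False using meet[of f "x \<rightharpoonup> \<^bold>0"] f(1) FL x neg by auto
    qed
    fix y z assume yz: "y \<in> carrier L" "z \<in> carrier L"
    {
      assume "y \<curlywedge> z \<in> N"
      then obtain f where f: "f \<in> F" "(f \<curlywedge> x) \<curlywedge> (y \<curlywedge> z) = f \<curlywedge> x" by (auto simp: N_def)
      let ?w = "f \<curlywedge> x"
      have w: "?w \<in> carrier L" using f FL x by auto
      have "?w \<curlywedge> y = ?w"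
        using f(2) w yz meet_idem[of y] by (metis ac(1,2) op_closed(3))
      moreover have "?w \<curlywedge> z = ?w"
        using f(2) w yz meet_idem[of z] by (metis ac(1) op_closed(3))
      ultimately show "y \<in> N" "z \<in> N" using f(1) yz by (auto simp: N_def)
    }
    assume "y \<in> N \<and> z \<in> N"
    then obtain f g where fg: "f \<in> F" "(f \<curlywedge> x) \<curlywedge> y = f \<curlywedge> x" "g \<in> F" "(g \<curlywedge> x) \<curlywedge> z = g \<curlywedge> x"
      by (auto simp: N_def)
    then have c: "f \<in> carrier L" "g \<in> carrier L" using FL by auto
    \<comment> \<open>The meet of the two witnesses works: f \<curlywedge> x and g \<curlywedge> x
      together contribute \<open>x\<close> twice, and idempotence merges the copies.\<close>
    have "((f \<curlywedge> g) \<curlywedge> x) \<curlywedge> (y \<curlywedge> z) = ((f \<curlywedge> x) \<curlywedge> y) \<curlywedge> ((g \<curlywedge> x) \<curlywedge> z)"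
    proof -
      have "((f \<curlywedge> x) \<curlywedge> y) \<curlywedge> ((g \<curlywedge> x) \<curlywedge> z) = (f \<curlywedge> g) \<curlywedge> (x \<curlywedge> x) \<curlywedge> (y \<curlywedge> z)"
        using c x yz by (simp add: ac)
      then show ?thesis using x by (simp add: meet_idem)
    qed
    also have "\<dots> = (f \<curlywedge> g) \<curlywedge> (x \<curlywedge> x)"
      unfolding fg using c x by (simp add: ac)
    finally have "((f \<curlywedge> g) \<curlywedge> x) \<curlywedge> (y \<curlywedge> z) = (f \<curlywedge> g) \<curlywedge> x" using x by (simp add: meet_idem)
    moreover have "f \<curlywedge> g \<in> F" using meet c fg by simp
    ultimately show "y \<curlywedge> z \<in> N" using yz by (auto simp: N_def)
  qed
  ultimately show ?thesis by blast
qed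

text \<open>Ultrafilters are coded as characteristic functions, extensional so that they are points
  of a product of two-point spaces. Each clause constrains only finitely many coordinates at a time,
  which makes the set closed. The last clause expresses maximality, and at 0 it gives membership of
  1.\<close>

definition ultrafilters :: "('a \<Rightarrow> bool) set"
  where "ultrafilters = {p \<in> extensional (carrier L). \<not> p \<^bold>0 \<and>
    (\<forall>x\<in>carrier L. \<forall>y\<in>carrier L. p (x \<curlywedge> y) = (p x \<and> p y)) \<and>
    (\<forall>x\<in>carrier L. p x \<or> p (x \<rightharpoonup> \<^bold>0))}"

text \<open>Zorn's lemma gives a maximal proper filter, and \<open>proper_filter_extend\<close>
  shows that a maximal one contains each element or its negation.\<close>

lemma ultrafilters_nonempty:
  assumes "\<^bold>0 \<noteq> \<^bold>1"
  shows "ultrafilters \<noteq> {}"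
proof -
  let ?A = "{F. proper_filter F}"
  \<comment> \<open>A meet equals 1 only if both factors do; this makes the singleton of 1 a filter,
    so that Zorn's lemma has a nonempty family to work on.\<close>
  have top: "x = \<^bold>1" if "x \<in> carrier L" "y \<in> carrier L" "x \<curlywedge> y = \<^bold>1" for x y
  proof -
    have "x = x \<curlywedge> (x \<curlywedge> y)" using that one_meet[of x] meet_commute[of x "\<^bold>1"] by simp
    also have "\<dots> = x \<curlywedge> y" using that(1,2) meet_assoc[of x x y] meet_idem[of x] by simp
    finally show ?thesis using that(3) by simp
  qed
  have "x \<curlywedge> y = \<^bold>1 \<longleftrightarrow> x = \<^bold>1 \<and> y = \<^bold>1" if "x \<in> carrier L" "y \<in> carrier L" for x y
    using that top[of x y] top[of y x] meet_commute[of x y] one_meet[of "\<^bold>1"] by auto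
  then have "proper_filter {\<^bold>1}" using assms by (auto simp: proper_filter_def)
  then have ne: "?A \<noteq> {}" by blast
  have chain: "\<Union>\<C> \<in> ?A" if C: "\<C> \<noteq> {}" "subset.chain ?A \<C>" for \<C>
  proof -
    have pf: "\<And>F. F \<in> \<C> \<Longrightarrow> proper_filter F"
      and tot: "\<And>F G. \<lbrakk>F \<in> \<C>; G \<in> \<C>\<rbrakk> \<Longrightarrow> F \<subseteq> G \<or> G \<subseteq> F"
      using C(2) by (auto simp: subset_chain_def)
    have "x \<curlywedge> y \<in> \<Union>\<C> \<longleftrightarrow> x \<in> \<Union>\<C> \<and> y \<in> \<Union>\<C>"
      if xy: "x \<in> carrier L" "y \<in> carrier L" for x y
    proof -
      have meet: "x \<curlywedge> y \<in> F \<longleftrightarrow> x \<in> F \<and> y \<in> F" if "F \<in> \<C>" for F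
        using pf[OF that] xy by (simp add: proper_filter_def)
      \<comment> \<open>Two members of a chain are comparable, so the larger one contains both
        points.\<close>
      have "\<exists>F\<in>\<C>. x \<in> F \<and> y \<in> F" if "x \<in> \<Union>\<C>" "y \<in> \<Union>\<C>"
        using that tot by blast
      then show ?thesis using meet by blast
    qed
    moreover have "\<Union>\<C> \<subseteq> carrier L" "\<^bold>1 \<in> \<Union>\<C>" "\<^bold>0 \<notin> \<Union>\<C>"
    proof -
      have "F \<subseteq> carrier L" "\<^bold>1 \<in> F" "\<^bold>0 \<notin> F" if "F \<in> \<C>" for F
        using pf[OF that] by (simp_all add: proper_filter_def)
      then show "\<Union>\<C> \<subseteq> carrier L" "\<^bold>1 \<in> \<Union>\<C>" "\<^bold>0 \<notin> \<Union>\<C>" using C(1) by blast+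
    qed
    ultimately show ?thesis by (simp add: proper_filter_def)
  qed
  obtain M where M: "proper_filter M" "\<And>F. \<lbrakk>proper_filter F; M \<subseteq> F\<rbrakk> \<Longrightarrow> F = M"
    using subset_Zorn_nonempty[OF ne chain] unfolding mem_Collect_eq by blast
  have neg: "x \<in> M \<or> x \<rightharpoonup> \<^bold>0 \<in> M" if x: "x \<in> carrier L" for x
  proof (rule disjCI)
    assume "x \<rightharpoonup> \<^bold>0 \<notin> M"
    then obtain F where "proper_filter F" "M \<subseteq> F" "x \<in> F"
      using proper_filter_extend[OF M(1) x] by blast
    then show "x \<in> M" using M(2)[of F] by simp
  qed
  have "\<^bold>0 \<notin> M" "\<And>x y. \<lbrakk>x \<in> carrier L; y \<in> carrier L\<rbrakk> \<Longrightarrow> x \<curlywedge> y \<in> M \<longleftrightarrow> x \<in> M \<and> y \<in> M"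
    using M(1) by (simp_all add: proper_filter_def)
  with neg have "(\<lambda>x\<in>carrier L. x \<in> M) \<in> ultrafilters"
    by (simp add: ultrafilters_def)
  then show ?thesis by blast
qed

lemma ultrafilter_neg:
  assumes "p \<in> ultrafilters" "x \<in> carrier L"
  shows "p (x \<rightharpoonup> \<^bold>0) \<longleftrightarrow> \<not> p x"
proof -
  have "p (x \<curlywedge> (x \<rightharpoonup> \<^bold>0)) \<longleftrightarrow> p x \<and> p (x \<rightharpoonup> \<^bold>0)" "p x \<or> p (x \<rightharpoonup> \<^bold>0)" "\<not> p \<^bold>0"
    using assms by (simp_all add: ultrafilters_def)
  then show ?thesis using meet_neg[OF assms(2)] by auto
qed

text \<open>The clauses defining an ultrafilter mention only 0, meets and negations, all of which
  \<open>h\<close> preserves. The use is with inverses of automorphisms.\<close>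

lemma ultrafilter_hom:
  assumes p: "p \<in> ultrafilters" and h: "h \<in> heyting_hom L L"
  shows "(\<lambda>x\<in>carrier L. p (h x)) \<in> ultrafilters"
proof -
  have "h \<^bold>0 = \<^bold>0" and mem: "\<And>x. x \<in> carrier L \<Longrightarrow> h x \<in> carrier L"
    and ops: "\<And>x y. \<lbrakk>x \<in> carrier L; y \<in> carrier L\<rbrakk> \<Longrightarrow> h (x \<curlywedge> y) = h x \<curlywedge> h y"
      "\<And>x. x \<in> carrier L \<Longrightarrow> h (x \<rightharpoonup> \<^bold>0) = h x \<rightharpoonup> \<^bold>0"
    using h by (auto simp: heyting_hom_def)
  then show ?thesis using p by (simp add: ultrafilters_def)
qed

section \<open>The compact Hausdorff space of ultrafilters\<close>

definition ultrafilter_space :: "('a \<Rightarrow> bool) topology"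
  where "ultrafilter_space =
    subtopology (product_topology (\<lambda>_. discrete_topology UNIV) (carrier L)) ultrafilters"

lemma topspace_ultrafilter_space: "topspace ultrafilter_space = ultrafilters"
  by (auto simp: ultrafilter_space_def ultrafilters_def PiE_def)

lemma Hausdorff_ultrafilter_space: "Hausdorff_space ultrafilter_space"
  unfolding ultrafilter_space_def
  by (simp add: Hausdorff_space_subtopology Hausdorff_space_product_topology)

text \<open>By Tychonoff the full product is compact, and the ultrafilters are an intersection of
  closed conditions on one, two or three coordinates.\<close>

lemma compact_ultrafilter_space: "compact_space ultrafilter_space"
proof -
  let ?P = "product_topology (\<lambda>_. discrete_topology (UNIV :: bool set)) (carrier L)"
  let ?E = "\<lambda>x v. {p \<in> topspace ?P. p x = v}"
  have ev: "closedin ?P (?E x v)" if "x \<in> carrier L" for x v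
  proof -
    have "continuous_map ?P (discrete_topology UNIV) (\<lambda>p. p x)"
      using that by (rule continuous_map_product_projection)
    from closedin_continuous_map_preimage[OF this, of "{v}"] show ?thesis by simp
  qed
  have zero: "closedin ?P {p \<in> topspace ?P. \<not> p \<^bold>0}"
    using ev[of "\<^bold>0" False] by simp
  have meet: "closedin ?P {p \<in> topspace ?P. p (x \<curlywedge> y) = (p x \<and> p y)}"
    if "x \<in> carrier L" "y \<in> carrier L" for x y
  proof -
    \<comment> \<open>The truth table of the conjunction, split by the value of \<open>p\<close> at
      the meet, as a finite union of closed cylinders.\<close>
    have "closedin ?P (?E (x \<curlywedge> y) True \<inter> (?E x True \<inter> ?E y True) \<union>
        ?E (x \<curlywedge> y) False \<inter> (?E x False \<union> ?E y False))"
      using that by (intro closedin_Un closedin_Int ev op_closed(3))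
    also have "?E (x \<curlywedge> y) True \<inter> (?E x True \<inter> ?E y True) \<union>
        ?E (x \<curlywedge> y) False \<inter> (?E x False \<union> ?E y False) =
        {p \<in> topspace ?P. p (x \<curlywedge> y) = (p x \<and> p y)}"
      by blast
    finally show ?thesis .
  qed
  have neg: "closedin ?P {p \<in> topspace ?P. p x \<or> p (x \<rightharpoonup> \<^bold>0)}" if "x \<in> carrier L" for x
  proof -
    have "closedin ?P (?E x True \<union> ?E (x \<rightharpoonup> \<^bold>0) True)"
      using that by (intro closedin_Un ev op_closed)
    also have "?E x True \<union> ?E (x \<rightharpoonup> \<^bold>0) True = {p \<in> topspace ?P. p x \<or> p (x \<rightharpoonup> \<^bold>0)}"
      by blast
    finally show ?thesis .
  qed
  have ne: "carrier L \<noteq> {}" using op_closed(1) by blast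
  have "closedin ?P ({p \<in> topspace ?P. \<not> p \<^bold>0} \<inter>
      (\<Inter>x\<in>carrier L. \<Inter>y\<in>carrier L. {p \<in> topspace ?P. p (x \<curlywedge> y) = (p x \<and> p y)}) \<inter>
      (\<Inter>x\<in>carrier L. {p \<in> topspace ?P. p x \<or> p (x \<rightharpoonup> \<^bold>0)}))" (is "closedin ?P ?C")
    by (intro closedin_Int closedin_INT ne zero meet neg)
  also have "?C = {p \<in> topspace ?P. \<not> p \<^bold>0 \<and>
      (\<forall>x\<in>carrier L. \<forall>y\<in>carrier L. p (x \<curlywedge> y) = (p x \<and> p y)) \<and>
      (\<forall>x\<in>carrier L. p x \<or> p (x \<rightharpoonup> \<^bold>0))}"
    unfolding set_eq_iff Int_iff INT_iff mem_Collect_eq using ne by blast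
  also have "\<dots> = ultrafilters"
    by (simp add: ultrafilters_def PiE_def)
  finally show ?thesis
    unfolding ultrafilter_space_def
    by (intro compact_space_subtopology closedin_compact_space)
      (auto simp: compact_space_product_topology compact_space_discrete_topology)
qed

lemma openin_ultrafilter_space_eval:
  assumes "x \<in> carrier L"
  shows "openin ultrafilter_space {p \<in> ultrafilters. p x = v}"
proof -
  have "continuous_map ultrafilter_space (discrete_topology UNIV) (\<lambda>p. p x)"
    unfolding ultrafilter_space_def
    by (intro continuous_map_from_subtopology continuous_map_product_projection assms)
  from openin_continuous_map_preimage[OF this, of "{v}"] show ?thesis
    by (simp add: topspace_ultrafilter_space)
qed

section \<open>The continuous action of automorphisms on ultrafilters\<close>

definition ultrafilter_action :: "('a \<Rightarrow> 'a) \<Rightarrow> ('a \<Rightarrow> bool) \<Rightarrow> 'a \<Rightarrow> bool"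
  where "ultrafilter_action g =
    (\<lambda>p\<in>ultrafilters. \<lambda>x\<in>carrier L. p (inv_into (carrier L) g x))"

lemma heyting_auto_bij: "g \<in> heyting_auto L \<Longrightarrow> bij_betw g (carrier L) (carrier L)"
  by (simp add: heyting_auto_def Bij_def)

lemma ultrafilter_action_closed:
  assumes "g \<in> heyting_auto L" "p \<in> ultrafilters"
  shows "ultrafilter_action g p \<in> ultrafilters"
proof -
  have "inv_into (carrier L) g \<in> heyting_hom L L"
    using heyting_iso_inv_into[OF closed heyting_autoD(2)[OF assms(1)]] by (simp add: heyting_iso_def)
  from ultrafilter_hom[OF assms(2) this] show ?thesis
    using assms(2) by (simp add: ultrafilter_action_def)
qed

text \<open>Precomposing with the inverse makes this a left action, sending an ultrafilter to its
  image under \<open>g\<close>. Evaluation at points \<open>g x\<close> cancels the inverse.\<close>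

lemma ultrafilter_action_apply:
  assumes "g \<in> heyting_auto L" "p \<in> ultrafilters" "x \<in> carrier L"
  shows "ultrafilter_action g p (g x) = p x"
  using assms heyting_auto_bij[OF assms(1)]
  by (simp add: ultrafilter_action_def heyting_autoD bij_betw_inv_into_left)

text \<open>Since \<open>g\<close> is onto the carrier, comparing at the points \<open>g x\<close>
  suffices; these are the points where \<open>ultrafilter_action_apply\<close> evaluates the
  action.\<close>

lemma ultrafilter_eqI:
  assumes "p \<in> ultrafilters" "q \<in> ultrafilters" "g \<in> heyting_auto L"
    and "\<And>x. x \<in> carrier L \<Longrightarrow> p (g x) = q (g x)"
  shows "p = q"
proof (rule extensionalityI[of _ "carrier L"])
  show "p \<in> extensional (carrier L)" "q \<in> extensional (carrier L)"
    using assms by (auto simp: ultrafilters_def)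
  fix y assume "y \<in> carrier L"
  then obtain x where "x \<in> carrier L" "y = g x"
    using heyting_auto_bij[OF assms(3)] by (auto simp: bij_betw_def)
  then show "p y = q y" using assms(4) by simp
qed

lemma continuous_action_ultrafilter:
  "continuous_action (Aut L) (pointwise_topology L) ultrafilter_space ultrafilter_action"
  unfolding continuous_action_def
proof
  let ?T = "pointwise_topology L"
  interpret topological_group "Aut L" ?T by (rule topological_group_Aut)
  have carr: "carrier (Aut L) = heyting_auto L" by (simp add: Aut_def)
  have mult: "(f \<otimes>\<^bsub>Aut L\<^esub> g) x = f (g x)"
    if "f \<in> heyting_auto L" "g \<in> heyting_auto L" "x \<in> carrier L" for f g x
    using that by (simp add: Aut_def BijGroup_def heyting_autoD compose_def)
  have one: "\<one>\<^bsub>Aut L\<^esub> x = x" if "x \<in> carrier L" for x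
    using that by (simp add: Aut_def BijGroup_def)
  show "group_action (Aut L) (topspace ultrafilter_space) ultrafilter_action"
    unfolding topspace_ultrafilter_space
  proof (rule group_actionI)
    show "group (Aut L)" by (rule is_group)
    show "ultrafilter_action g \<in> extensional ultrafilters" for g
      by (simp add: ultrafilter_action_def)
    show "ultrafilter_action g p \<in> ultrafilters"
      if "g \<in> carrier (Aut L)" "p \<in> ultrafilters" for g p
      using that ultrafilter_action_closed by (simp add: carr)
    have id: "\<one>\<^bsub>Aut L\<^esub> \<in> heyting_auto L" using one_closed by (simp add: carr)
    show "ultrafilter_action \<one>\<^bsub>Aut L\<^esub> p = p" if p: "p \<in> ultrafilters" for p
      using ultrafilter_action_apply[OF id p]
      by (intro ultrafilter_eqI[OF ultrafilter_action_closed[OF id p] p id]) (simp add: one)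
    show "ultrafilter_action (g \<otimes>\<^bsub>Aut L\<^esub> h) p = ultrafilter_action g (ultrafilter_action h p)"
      if "g \<in> carrier (Aut L)" "h \<in> carrier (Aut L)" and p: "p \<in> ultrafilters" for g h p
    proof -
      have g: "g \<in> heyting_auto L" and h: "h \<in> heyting_auto L"
        and gh: "g \<otimes>\<^bsub>Aut L\<^esub> h \<in> heyting_auto L"
        using that m_closed by (auto simp: carr)
      note hp = ultrafilter_action_closed[OF h p]
      show ?thesis
      proof (rule ultrafilter_eqI[OF ultrafilter_action_closed[OF gh p]
            ultrafilter_action_closed[OF g hp] gh])
        fix x assume x: "x \<in> carrier L"
        show "ultrafilter_action (g \<otimes>\<^bsub>Aut L\<^esub> h) p ((g \<otimes>\<^bsub>Aut L\<^esub> h) x) =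
            ultrafilter_action g (ultrafilter_action h p) ((g \<otimes>\<^bsub>Aut L\<^esub> h) x)"
          using ultrafilter_action_apply[OF gh p x]
            ultrafilter_action_apply[OF g hp heyting_autoD(4)[OF h x]]
            ultrafilter_action_apply[OF h p x] by (simp add: mult[OF g h x])
      qed
    qed
  qed
  let ?TX = "prod_topology ?T ultrafilter_space"
  have cl: "(\<lambda>(g, p). ultrafilter_action g p) \<in> topspace ?TX \<rightarrow> ultrafilters"
    by (auto simp: topspace_pointwise_topology topspace_ultrafilter_space ultrafilter_action_closed)
  have "continuous_map ?TX (discrete_topology UNIV) (\<lambda>q. (case q of (g, p) \<Rightarrow> ultrafilter_action g p) x)"
    if x: "x \<in> carrier L" for x
    unfolding continuous_map_def
  proof (intro conjI allI impI)
    fix V :: "bool set"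
    \<comment> \<open>The value of the translated ultrafilter at x = g y is \<open>p y\<close>.
      Sorting the pairs by this y and by the value \<open>v\<close> writes the preimage of
      \<open>V\<close> as a union of open rectangles.\<close>
    have "openin ?TX (\<Union>y\<in>carrier L. \<Union>v\<in>V. {g \<in> heyting_auto L. g y = x} \<times> {p \<in> ultrafilters. p y = v})"
    proof (rule openin_Union, elim imageE, hypsubst, rule openin_Union, elim imageE, hypsubst)
      fix y v assume "y \<in> carrier L"
      then show "openin ?TX ({g \<in> heyting_auto L. g y = x} \<times> {p \<in> ultrafilters. p y = v})"
        using openin_pointwise_topology_eval[of y L x] openin_ultrafilter_space_eval[of y v] x
        by (simp add: openin_prod_Times_iff)
    qed
    also have "(\<Union>y\<in>carrier L. \<Union>v\<in>V. {g \<in> heyting_auto L. g y = x} \<times> {p \<in> ultrafilters. p y = v}) =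
      {q \<in> topspace ?TX. (case q of (g, p) \<Rightarrow> ultrafilter_action g p) x \<in> V}"
    proof (intro subset_antisym subsetI)
      fix q assume q: "q \<in> {q \<in> topspace ?TX. (case q of (g, p) \<Rightarrow> ultrafilter_action g p) x \<in> V}"
      obtain g p where gp: "q = (g, p)" by (cases q)
      have g: "g \<in> heyting_auto L" and p: "p \<in> ultrafilters" and V: "ultrafilter_action g p x \<in> V"
        using q by (simp_all add: gp topspace_pointwise_topology topspace_ultrafilter_space)
      have "x \<in> g ` carrier L" using x bij_betw_imp_surj_on[OF heyting_auto_bij[OF g]] by simp
      then obtain y where y: "y \<in> carrier L" "g y = x" by blast
      have "p y \<in> V" using ultrafilter_action_apply[OF g p y(1)] V by (simp add: y(2))
      then show "q \<in> (\<Union>y\<in>carrier L. \<Union>v\<in>V. {g \<in> heyting_auto L. g y = x} \<times> {p \<in> ultrafilters. p y = v})"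
        unfolding gp using g p y by (intro UN_I[of y] UN_I[of "p y"] SigmaI CollectI conjI) simp_all
    next
      fix q assume "q \<in> (\<Union>y\<in>carrier L. \<Union>v\<in>V. {g \<in> heyting_auto L. g y = x} \<times> {p \<in> ultrafilters. p y = v})"
      then obtain y g p where q: "q = (g, p)" "g \<in> heyting_auto L" "p \<in> ultrafilters"
          "y \<in> carrier L" "g y = x" "p y \<in> V"
        by (elim UN_E SigmaE CollectE conjE) simp
      then show "q \<in> {q \<in> topspace ?TX. (case q of (g, p) \<Rightarrow> ultrafilter_action g p) x \<in> V}"
        using ultrafilter_action_apply[OF q(2,3,4)]
        by (simp add: topspace_pointwise_topology topspace_ultrafilter_space)
    qed
    finally show "openin ?TX {q \<in> topspace ?TX. (case q of (g, p) \<Rightarrow> ultrafilter_action g p) x \<in> V}" .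
  qed simp
  moreover have "(\<lambda>(g, p). ultrafilter_action g p) ` topspace ?TX \<subseteq> extensional (carrier L)"
  proof -
    have "ultrafilters \<subseteq> extensional (carrier L)" by (auto simp: ultrafilters_def)
    then show ?thesis using cl by blast
  qed
  ultimately show "continuous_map ?TX ultrafilter_space (\<lambda>(g, p). ultrafilter_action g p)"
    using cl unfolding ultrafilter_space_def continuous_map_in_subtopology continuous_map_componentwise
    by blast
qed

end


section \<open>Boolean subalgebras of the limit\<close>

text \<open>A finite Boolean algebra on a whole type: its atoms are the singletons of points of
  \<open>'b\<close>, and embeddings are injective total functions.\<close>

definition powerset_heyting :: "'b set heyting"
  where "powerset_heyting = \<lparr>carrier = UNIV, hzero = {}, hone = UNIV,
    hmeet = (\<inter>), hjoin = (\<union>), himp = (\<lambda>X Y. - X \<union> Y)\<rparr>"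

lemma finite_nontrivial_powerset_heyting:
  "finite_nontrivial_heyting (powerset_heyting :: 'b::finite set heyting)"
proof -
  have "heyting_algebra (powerset_heyting :: 'b set heyting)"
    by unfold_locales (auto simp: powerset_heyting_def closed_under_ops_def)
  then show ?thesis by (simp add: finite_nontrivial_heyting_def powerset_heyting_def)
qed

lemma powerset_homD:
  assumes "k \<in> heyting_hom powerset_heyting L"
  shows "k X \<in> carrier L" "k {} = \<^bold>0\<^bsub>L\<^esub>" "k UNIV = \<^bold>1\<^bsub>L\<^esub>"
    "k (X \<inter> Y) = k X \<curlywedge>\<^bsub>L\<^esub> k Y" "k (X \<union> Y) = k X \<curlyvee>\<^bsub>L\<^esub> k Y" "k (- X \<union> Y) = k X \<rightharpoonup>\<^bsub>L\<^esub> k Y"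
  using assms unfolding heyting_hom_def powerset_heyting_def partial_object.simps heyting.simps
  by blast+

lemma (in heyting_algebra) subalgebra_generated_least:
  assumes "X \<subseteq> S" "S \<subseteq> carrier L" "closed_under_ops L S"
    and "\<And>S'. \<lbrakk>X \<subseteq> S'; S' \<subseteq> carrier L; closed_under_ops L S'\<rbrakk> \<Longrightarrow> S \<subseteq> S'"
  shows "subalgebra_generated L X = L\<lparr>carrier := S\<rparr>"
proof -
  have "\<Inter>{S. X \<subseteq> S \<and> S \<subseteq> carrier L \<and> closed_under_ops L S} = S"
    using assms by blast
  then show ?thesis by (simp add: subalgebra_generated_def)
qed

section \<open>Copies of finite powerset algebras in the limit, and conjugacy of their
  elements\<close>

context fraisse_limit
begin

text \<open>The subalgebra generated by the empty set is nontrivial by \<open>age_sound\<close>, and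
  it has the same constants as \<open>L\<close>.\<close>

lemma zero_neq_one: "\<^bold>0 \<noteq> \<^bold>1"
proof -
  have "subalgebra_generated L {} \<in> fg_substructures L" by (auto simp: fg_substructures_def)
  from age_sound[OF this] show ?thesis
    by (simp add: finite_nontrivial_heyting_def subalgebra_generated_def)
qed

text \<open>The age contains a copy of the powerset algebra; the inverse of that isomorphism is an
  embedding into \<open>L\<close>, because a generated subalgebra differs from \<open>L\<close> only
  in its carrier.\<close>

lemma powerset_embedding:
  obtains k :: "'b::finite set \<Rightarrow> 'a"
  where "inj k" "k \<in> heyting_hom powerset_heyting L"
proof -
  let ?B = "powerset_heyting :: 'b set heyting"
  obtain A h where A: "A \<in> fg_substructures L" and h: "h \<in> heyting_iso A ?B"
    using age_complete_any[OF finite_nontrivial_powerset_heyting] by blast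
  interpret A: heyting_algebra A using age_sound[OF A] by (simp add: finite_nontrivial_heyting_def)
  obtain X where X: "X \<subseteq> carrier L" "A = subalgebra_generated L X"
    using A by (auto simp: fg_substructures_def)
  have "carrier A \<subseteq> carrier L"
    using X closed by (auto simp: subalgebra_generated_def)
  moreover define k where "k = inv_into (carrier A) h"
  moreover have "k \<in> heyting_iso ?B A" unfolding k_def by (rule heyting_iso_inv_into[OF A.closed h])
  moreover from X(2) have "\<^bold>0\<^bsub>A\<^esub> = \<^bold>0" "\<^bold>1\<^bsub>A\<^esub> = \<^bold>1" "hmeet A = hmeet L" "hjoin A = hjoin L" "himp A = himp L"
    by (simp_all add: subalgebra_generated_def)
  ultimately have "k \<in> heyting_hom ?B L" "inj_on k (carrier ?B)"
    by (auto simp: heyting_iso_def heyting_hom_def bij_betw_def)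
  then have "inj k" "k \<in> heyting_hom ?B L" by (simp_all add: powerset_heyting_def)
  then show ?thesis by (rule that)
qed

text \<open>Both \<open>k S\<close> and \<open>k T\<close> generate four-element Boolean
  subalgebras. Sending S to T and the complement of S to that of T is an isomorphism between these,
  which ultrahomogeneity extends to all of \<open>L\<close>.\<close>

lemma complemented_conjugate:
  assumes inj: "inj k" and k: "k \<in> heyting_hom powerset_heyting L"
    and S: "S \<noteq> {}" "S \<noteq> UNIV" and T: "T \<noteq> {}" "T \<noteq> UNIV"
  shows "\<exists>f\<in>heyting_auto L. f (k S) = k T"
proof -
  have ops: "\<^bold>0 = k {}" "\<^bold>1 = k UNIV" "k X \<curlywedge> k Y = k (X \<inter> Y)" "k X \<curlyvee> k Y = k (X \<union> Y)"
      "k X \<rightharpoonup> k Y = k (- X \<union> Y)" "k X \<in> carrier L" for X Y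
    using powerset_homD[OF k] by simp_all
  let ?Q = "\<lambda>S. {{}, S, - S, UNIV}"
  have gen: "subalgebra_generated L {k S} = L\<lparr>carrier := k ` ?Q S\<rparr>" for S
  proof (rule subalgebra_generated_least)
    show "{k S} \<subseteq> k ` ?Q S" "k ` ?Q S \<subseteq> carrier L" by (auto simp: ops)
    show "closed_under_ops L (k ` ?Q S)"
      by (auto simp: closed_under_ops_def ops)
    fix S' assume S': "{k S} \<subseteq> S'" "S' \<subseteq> carrier L" "closed_under_ops L S'"
    \<comment> \<open>The complement of S enters a subalgebra as the implication from
      \<open>k S\<close> to 0.\<close>
    then have "k {} \<in> S'" "k UNIV \<in> S'" "k S \<in> S'" "k S \<rightharpoonup> k {} \<in> S'"
      by (auto simp: closed_under_ops_def simp flip: ops(1,2))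
    then show "k ` ?Q S \<subseteq> S'" by (simp add: ops)
  qed
  have fg: "L\<lparr>carrier := k ` ?Q S\<rparr> \<in> fg_substructures L" for S
    unfolding fg_substructures_def using gen[of S] ops by (auto intro!: exI[of _ "{k S}"])
  \<comment> \<open>Only the four sets in \<open>?Q S\<close> matter; the last branch is there for
    the complement of S.\<close>
  define r where "r X = (if X = {} then {} else if X = UNIV then UNIV else if X = S then T else - T)" for X
  define h where "h = k \<circ> r \<circ> inv_into UNIV k"
  have hk: "h (k X) = k (r X)" for X by (simp add: h_def inj)
  have neq: "S \<noteq> - S" "T \<noteq> - T" "- S \<noteq> {}" "- S \<noteq> UNIV" "- T \<noteq> {}" "- T \<noteq> UNIV"
    using S T by auto
  have r: "r {} = {}" "r UNIV = UNIV" "r S = T" "r (- S) = - T"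
    using S neq by (auto simp: r_def)
  have "h \<in> heyting_iso (L\<lparr>carrier := k ` ?Q S\<rparr>) (L\<lparr>carrier := k ` ?Q T\<rparr>)"
    unfolding heyting_iso_def
  proof (intro CollectI conjI)
    show "h \<in> heyting_hom (L\<lparr>carrier := k ` ?Q S\<rparr>) (L\<lparr>carrier := k ` ?Q T\<rparr>)"
      by (auto simp: heyting_hom_def ops hk r)
    have "inj_on h (k ` ?Q S)"
      \<comment> \<open>Injectivity rests on \<open>T\<close> being nonempty and proper: the four
        sets in \<open>?Q T\<close> are then distinct.\<close>
      by (auto simp: inj_on_def hk r inj_eq[OF inj] T neq neq[symmetric] T[symmetric])
    then show "bij_betw h (carrier (L\<lparr>carrier := k ` ?Q S\<rparr>)) (carrier (L\<lparr>carrier := k ` ?Q T\<rparr>))"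
      by (auto simp: bij_betw_def hk r)
  qed
  from ultrahomogeneous[OF fg fg this] obtain f
    where "f \<in> heyting_auto L" "\<forall>x\<in>k ` ?Q S. f x = h x" by auto
  then show ?thesis by (auto simp: hk r)
qed

section \<open>The contradiction from an invariant measure\<close>

lemma not_amenable_Aut: "\<not> amenable (Aut L) (pointwise_topology L)"
proof
  assume am: "amenable (Aut L) (pointwise_topology L)"
  have "topspace (pointwise_topology L) = carrier (Aut L)"
    by (simp add: topspace_pointwise_topology Aut_def)
  \<comment> \<open>The ultrafilter space does not live on the type fixed in
    \<open>amenable\<close>, so the transfer \<open>amenable_any\<close> is used.\<close>
  with am obtain M where M: "regular_borel_prob ultrafilter_space M"
    and inv: "invariant_measure (Aut L) ultrafilter_action M"
    using amenable_any[OF am _ compact_ultrafilter_space Hausdorff_ultrafilter_space _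
        continuous_action_ultrafilter] ultrafilters_nonempty[OF zero_neq_one]
    by (auto simp: topspace_ultrafilter_space)
  interpret M: prob_space M using M by (simp add: regular_borel_prob_def)
  have sp: "space M = ultrafilters"
    and st: "sets M = sigma_sets ultrafilters {U. openin ultrafilter_space U}"
    using M by (simp_all add: regular_borel_prob_def topspace_ultrafilter_space)
  define E where "E x = {p \<in> ultrafilters. p x}" for x
  have E: "E x \<in> sets M" if "x \<in> carrier L" for x
    using openin_ultrafilter_space_eval[OF that, of True] by (auto simp: st E_def)
  \<comment> \<open>Invariance applies because the preimage of \<open>E (f x)\<close> under the
    action of \<open>f\<close> is \<open>E x\<close>.\<close>
  have conj: "M.prob (E (f x)) = M.prob (E x)" if f: "f \<in> heyting_auto L" and x: "x \<in> carrier L" for f x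
  proof -
    have "f \<in> carrier (Aut L)" using f by (simp add: Aut_def)
    have "continuous_map ultrafilter_space ultrafilter_space (ultrafilter_action f)"
      using continuous_action_continuous_map[OF continuous_action_ultrafilter]
        \<open>f \<in> carrier (Aut L)\<close> by (simp add: topspace_pointwise_topology Aut_def)
    from regular_borel_prob_distr(1)[OF M this Hausdorff_ultrafilter_space]
    have meas: "ultrafilter_action f \<in> measurable M M"
      by (simp add: sp st topspace_ultrafilter_space)
    have "M.prob (E (f x)) = measure (distr M M (ultrafilter_action f)) (E (f x))"
      using inv \<open>f \<in> carrier (Aut L)\<close> by (simp add: invariant_measure_def)
    also have "\<dots> = M.prob (ultrafilter_action f -` E (f x) \<inter> space M)"
      using f x by (intro measure_distr[OF meas] E) (simp add: heyting_autoD)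
    also have "ultrafilter_action f -` E (f x) \<inter> space M = E x"
      using f x by (auto simp: sp E_def ultrafilter_action_closed ultrafilter_action_apply)
    finally show ?thesis .
  qed
  \<comment> \<open>The type \<open>bool option\<close> has three elements, so its powerset algebra
    has eight elements and three atoms.\<close>
  obtain k :: "bool option set \<Rightarrow> 'a" where inj: "inj k" and k: "k \<in> heyting_hom powerset_heyting L"
    by (rule powerset_embedding)
  have ops: "k {} = \<^bold>0" "k (X \<inter> Y) = k X \<curlywedge> k Y" "k (- X) = k X \<rightharpoonup> \<^bold>0" "k X \<in> carrier L" for X Y
    using powerset_homD[OF k] powerset_homD(6)[OF k, of X "{}"] by simp_all
  have pk: "\<not> p (k {})" "p (k (X \<inter> Y)) = (p (k X) \<and> p (k Y))" "p (k (- X)) = (\<not> p (k X))"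
    if "p \<in> ultrafilters" for p X Y
    using that ultrafilter_neg[OF that ops(4)] by (auto simp: ops ultrafilters_def)
  \<comment> \<open>Joins do not occur in the definition of an ultrafilter; inside the Boolean copy
    De Morgan reduces them to meets and complements.\<close>
  have pU: "p (k (X \<union> Y)) = (p (k X) \<or> p (k Y))" if "p \<in> ultrafilters" for p X Y
    using pk[OF that] by (metis Compl_Un double_complement)
  let ?m = "\<lambda>X. M.prob (E (k X))"
  have eq: "?m X = ?m {None}" if X: "X \<noteq> {}" "X \<noteq> UNIV" for X
  proof -
    have "{None :: bool option} \<noteq> UNIV" by (metis UNIV_I option.distinct(1) singletonD)
    then obtain f where "f \<in> heyting_auto L" "f (k {None}) = k X"
      using complemented_conjugate[OF inj k _ _ X, of "{None}"] by blast
    then show ?thesis using conj[of f "k {None}"] by (simp add: ops)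
  qed
  have add: "?m (X \<union> Y) = ?m X + ?m Y" if "X \<inter> Y = {}" for X Y
  proof -
    have "E (k (X \<union> Y)) = E (k X) \<union> E (k Y)" by (auto simp: E_def pU)
    moreover have "E (k X) \<inter> E (k Y) = {}"
      using pk(1) pk(2)[of _ X Y] that by (auto simp: E_def)
    ultimately show ?thesis
      using M.finite_measure_Union[OF E E, of "k X" "k Y"] by (simp add: ops)
  qed
  have two: "{Some True, Some False} \<noteq> (UNIV :: bool option set)"
    by (metis UNIV_I insertE option.distinct(1) singletonD)
  have U: "{None} \<union> {Some True, Some False} = (UNIV :: bool option set)"
    by (auto simp: UNIV_option_conv UNIV_bool)
  have sing: "{Some b} \<noteq> (UNIV :: bool option set)" for b
    by (metis UNIV_I option.distinct(1) singletonD)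
  \<comment> \<open>The full set is the complement of the empty one, whose image lies in no
    ultrafilter.\<close>
  have "E (k UNIV) = space M"
    using pk(1) pk(3)[of _ "{}"] by (auto simp: E_def sp)
  then have "?m UNIV = 1" by (simp add: M.prob_space)
  moreover have "?m UNIV = ?m {None} + ?m {Some True, Some False}"
    using add[of "{None}" "{Some True, Some False}"] by (simp only: U) simp
  moreover have "?m {Some True, Some False} = ?m {Some True} + ?m {Some False}"
    using add[of "{Some True}" "{Some False}"] by (simp add: insert_commute)
  \<comment> \<open>With c the common mass of the nonempty proper sets, the complementary pair gives
    1 = c + c, while splitting the two-element set into atoms gives c = c + c, hence c = 0.\<close>
  ultimately show False using eq two sing by simp
qed

end

theorem corollary3p3:
  fixes L :: "'a heyting"
  assumes "fraisse_limit L"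
  shows "\<not> amenable (Aut L) (pointwise_topology L)"
  using assms by (rule fraisse_limit.not_amenable_Aut)

end
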